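(* For $1\le\mu\le n$, define $$\mathcal{M}(\mu,\sigma_{\min})=\Bigl\{M^\star=\lambda^\star u^\star u^{\star\top}:\ u^\star\in\mathbb{R}^n,\ \|u^\star\|_2=1,\ \tfrac12\sqrt{\mu/n}\le\|u^\star\|_\infty\le2\sqrt{\mu/n},\ |\lambda^\star|\ge\sigma_{\min}\sqrt n\Bigr\}.$$ Suppose that the observed matrix is $M=M^\star+H\in\mathbb{R}^{n\times n}$, where the entries $H_{ij}\sim\mathcal{N}(0,\sigma_{ij}^2)$, $1\le i,j\le n$, are independent and $0<\sigma_{\min}\le\sigma_{ij}\le\sigma$ for all $i,j\in[n]$. Then $$\inf_{\widehat M\in\mathbb{R}^{n\times n}}\ \sup_{M^\star\in\mathcal{M}(\mu,\sigma_{\min})}\ \mathbb{E}\bigl\|\widehat M-M^\star\bigr\|_\infty\ \ge\ \frac{\sigma_{\min}}8\sqrt{\frac{3\mu}{n}},$$ where the infimum is over all estimators $\widehat M$ based on $M$.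
   Context: For matrices, $\|A\|_\infty=\max_{i,j}|A_{ij}|$. The expectation is under the distribution of $M$ with true signal $M^\star$. *)

theory Defs
  imports "HOL-Probability.Probability"
begin

definition max_norm :: "real^'n^'n \<Rightarrow> real" where
  "max_norm A = Max {\<bar>A $ i $ j\<bar> | i j. True}"

definition outer_square :: "real^'n \<Rightarrow> real^'n^'n" where
  "outer_square u = (\<chi> i j. u $ i * u $ j)"

definition signal_class :: "real \<Rightarrow> real \<Rightarrow> (real^'n^'n) set" where
  "signal_class \<mu> \<sigma>min =
     {l *\<^sub>R outer_square u | (l::real) (u::real^'n).
        norm u = 1 \<and>
        1/2 * sqrt (\<mu> / real CARD('n)) \<le> infnorm u \<and>
        infnorm u \<le> 2 * sqrt (\<mu> / real CARD('n)) \<and>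
        \<bar>l\<bar> \<ge> \<sigma>min * sqrt (real CARD('n))}"

definition gaussian_noise ::
    "'w measure \<Rightarrow> ('n \<Rightarrow> 'n \<Rightarrow> real) \<Rightarrow> ('w \<Rightarrow> real^'n^'n) \<Rightarrow> bool" where
  "gaussian_noise P s H \<longleftrightarrow>
     prob_space.indep_vars P (\<lambda>_. borel) (\<lambda>(i, j) \<omega>. H \<omega> $ i $ j) UNIV \<and>
     (\<forall>i j. distributed P lborel (\<lambda>\<omega>. H \<omega> $ i $ j) (\<lambda>x. ennreal (normal_density 0 (s i j) x)))"

text \<open>The expected loss may be infinite for some estimators, so the risk is \<^typ>\<open>ennreal\<close>-valued.\<close>

definition risk ::
    "'w measure \<Rightarrow> ('w \<Rightarrow> real^'n^'n) \<Rightarrow> (real^'n^'n \<Rightarrow> real^'n^'n) \<Rightarrow> real^'n^'n \<Rightarrow> ennreal" where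
  "risk P H Mhat Mstar = (\<integral>\<^sup>+ \<omega>. ennreal (max_norm (Mhat (Mstar + H \<omega>) - Mstar)) \<partial>P)"

end

theory Submission imports Defs begin

text \<open>Le Cam's two-point method, applied to a single matrix entry. Two signals whose difference has
  Frobenius norm at most \<open>\<sigma>min\<close> give observation densities \<open>p\<close>, \<open>q\<close> with \<open>\<integral> min p q \<ge> 1/2\<close>, so the two
  risks add up to at least half the difference of the signals in any chosen entry. It remains to
  find two such signals that differ by \<open>(sqrt 3 / 2) \<sigma>min sqrt (\<mu>/n)\<close> in some entry. If
  \<open>sqrt (\<mu>/n) \<ge> 1/2\<close>, take a coordinate vector for \<open>u\<close> and change the eigenvalue by \<open>\<sigma>min\<close>. Otherwise
  take \<open>u\<^sub>p = sqrt (3\<mu>/(2n))\<close>, \<open>u\<^sub>q = \<plusminus>1/sqrt (8n)\<close> and all other coordinates equal; the signals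
  for the two signs of \<open>u\<^sub>q\<close> are far apart in entry \<open>(p, q)\<close>.\<close>

section \<open>Densities on finite product spaces\<close>

text \<open>By Tonelli both measures agree on boxes, and boxes determine a finite product of
  sigma-finite measures. Sigma-finiteness of the weighted factors is assumed separately, since
  \<open>f i\<close> may take infinite values.\<close>

lemma density_PiM_prod:
  fixes f :: "'i \<Rightarrow> 'a \<Rightarrow> ennreal"
  assumes fin: "finite I"
    and M: "product_sigma_finite M"
    and D: "product_sigma_finite (\<lambda>i. density (M i) (f i))"
    and f: "\<And>i. f i \<in> borel_measurable (M i)"
  shows "density (Pi\<^sub>M I M) (\<lambda>x. \<Prod>i\<in>I. f i (x i)) = Pi\<^sub>M I (\<lambda>i. density (M i) (f i))"
proof -
  interpret M: product_sigma_finite M by (rule M)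
  interpret D: product_sigma_finite "\<lambda>i. density (M i) (f i)" by (rule D)
  note f[measurable]
  show ?thesis
  proof (rule D.PiM_eqI)
    show "finite I" by (rule fin)
    show "sets (density (Pi\<^sub>M I M) (\<lambda>x. \<Prod>i\<in>I. f i (x i))) = sets (Pi\<^sub>M I (\<lambda>i. density (M i) (f i)))"
      by (simp cong: sets_PiM_cong)
    fix A assume A: "\<And>i. i \<in> I \<Longrightarrow> A i \<in> sets (density (M i) (f i))"
    then have [measurable]: "A i \<in> sets (M i)" if "i \<in> I" for i
      using that by simp
    have box: "Pi\<^sub>E I A \<in> sets (Pi\<^sub>M I M)"
      using fin by (intro sets_PiM_I_finite) simp_all
    have "emeasure (density (Pi\<^sub>M I M) (\<lambda>x. \<Prod>i\<in>I. f i (x i))) (Pi\<^sub>E I A)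
        = (\<integral>\<^sup>+x. (\<Prod>i\<in>I. f i (x i)) * indicator (Pi\<^sub>E I A) x \<partial>Pi\<^sub>M I M)"
      using box by (simp add: emeasure_density)
    also have "\<dots> = (\<integral>\<^sup>+x. (\<Prod>i\<in>I. f i (x i) * indicator (A i) (x i)) \<partial>Pi\<^sub>M I M)"
    proof (intro nn_integral_cong)
      fix x assume "x \<in> space (Pi\<^sub>M I M)"
      then have "indicator (Pi\<^sub>E I A) x = (\<Prod>i\<in>I. indicator (A i) (x i) :: ennreal)"
        using fin by (auto simp: indicator_def space_PiM PiE_iff prod.neutral)
      then show "(\<Prod>i\<in>I. f i (x i)) * indicator (Pi\<^sub>E I A) x = (\<Prod>i\<in>I. f i (x i) * indicator (A i) (x i))"
        by (simp add: prod.distrib)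
    qed
    also have "\<dots> = (\<Prod>i\<in>I. \<integral>\<^sup>+x. f i x * indicator (A i) x \<partial>M i)"
      using fin by (intro M.product_nn_integral_prod) simp_all
    also have "\<dots> = (\<Prod>i\<in>I. emeasure (density (M i) (f i)) (A i))"
      by (intro prod.cong) (simp_all add: emeasure_density)
    finally show "emeasure (density (Pi\<^sub>M I M) (\<lambda>x. \<Prod>i\<in>I. f i (x i))) (Pi\<^sub>E I A)
        = (\<Prod>i\<in>I. emeasure (density (M i) (f i)) (A i))" .
  qed
qed

text \<open>The index type is abstract so that \<open>k\<close> can be a pair of matrix indices:
  independent entries turn into a product measure over pairs.\<close>

definition normal_prod_density :: "('k::finite \<Rightarrow> real) \<Rightarrow> ('k \<Rightarrow> real) \<Rightarrow> ('k \<Rightarrow> real) \<Rightarrow> real" where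
  "normal_prod_density m s x = (\<Prod>k\<in>UNIV. normal_density (m k) (s k) (x k))"

lemma measurable_normal_prod_density [measurable]:
  "normal_prod_density m s \<in> borel_measurable (Pi\<^sub>M UNIV (\<lambda>_. lborel))"
  unfolding normal_prod_density_def by measurable

lemma normal_prod_density_nonneg [simp]: "0 \<le> normal_prod_density m s x"
  unfolding normal_prod_density_def by (intro prod_nonneg) simp

lemma nn_integral_normal_prod_density:
  assumes "\<And>k. 0 < s k"
  shows "(\<integral>\<^sup>+x. normal_prod_density m s x \<partial>Pi\<^sub>M UNIV (\<lambda>_. lborel)) = 1"
proof -
  interpret product_sigma_finite "\<lambda>_::'a. lborel :: real measure" ..
  have one: "(\<integral>\<^sup>+x. normal_density (m k) (s k) x \<partial>lborel) = 1" for k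
  proof -
    interpret prob_space "density lborel (normal_density (m k) (s k))"
      using assms by (rule prob_space_normal_density)
    show ?thesis
      using emeasure_space_1 by (simp add: emeasure_density)
  qed
  have "(\<integral>\<^sup>+x. normal_prod_density m s x \<partial>Pi\<^sub>M UNIV (\<lambda>_. lborel))
      = (\<integral>\<^sup>+x. (\<Prod>k\<in>UNIV. ennreal (normal_density (m k) (s k) (x k))) \<partial>Pi\<^sub>M UNIV (\<lambda>_. lborel))"
    by (simp add: normal_prod_density_def prod_ennreal)
  also have "\<dots> = 1"
    by (subst product_nn_integral_prod) (simp_all add: one)
  finally show ?thesis .
qed

section \<open>Overlap of two Gaussian product densities\<close>

text \<open>Completing the square around the midpoint of \<open>a\<close> and \<open>b\<close>: the
  geometric mean of two normal densities with equal variance is a normal density centred there,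
  scaled by their Hellinger affinity.\<close>

lemma normal_density_mult_shift:
  assumes "0 < s"
  shows "normal_density a s x * normal_density b s x
    = (exp (- (a - b)\<^sup>2 / (8 * s\<^sup>2)) * normal_density ((a + b) / 2) s x)\<^sup>2"
proof -
  have e: "-(x - a)\<^sup>2 / (2 * s\<^sup>2) + -(x - b)\<^sup>2 / (2 * s\<^sup>2)
      = 2 * (- (a - b)\<^sup>2 / (8 * s\<^sup>2) + -(x - (a + b) / 2)\<^sup>2 / (2 * s\<^sup>2))"
    using assms by (simp add: divide_simps) (simp add: power2_eq_square field_simps)
  have "normal_density a s x * normal_density b s x
      = (1 / sqrt (2 * pi * s\<^sup>2))\<^sup>2 * exp (-(x - a)\<^sup>2 / (2 * s\<^sup>2) + -(x - b)\<^sup>2 / (2 * s\<^sup>2))"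
    by (simp only: normal_density_def exp_add) (simp add: power2_eq_square)
  also have "\<dots> = (exp (- (a - b)\<^sup>2 / (8 * s\<^sup>2)) * normal_density ((a + b) / 2) s x)\<^sup>2"
    unfolding e normal_density_def exp_double exp_add by (simp add: power_mult_distrib power_divide)
  finally show ?thesis .
qed

lemma normal_prod_density_mult_shift:
  assumes "\<And>k. 0 < s k"
  shows "normal_prod_density a s x * normal_prod_density b s x
    = (exp (- (\<Sum>k\<in>UNIV. (a k - b k)\<^sup>2 / (8 * (s k)\<^sup>2))) * normal_prod_density (\<lambda>k. (a k + b k) / 2) s x)\<^sup>2"
proof -
  have "normal_prod_density a s x * normal_prod_density b s x
      = (\<Prod>k\<in>UNIV. (exp (- (a k - b k)\<^sup>2 / (8 * (s k)\<^sup>2)) * normal_density ((a k + b k) / 2) (s k) (x k))\<^sup>2)"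
    unfolding normal_prod_density_def prod.distrib[symmetric]
    by (intro prod.cong refl normal_density_mult_shift assms)
  also have "\<dots> = ((\<Prod>k\<in>UNIV. exp (- (a k - b k)\<^sup>2 / (8 * (s k)\<^sup>2)))
       * normal_prod_density (\<lambda>k. (a k + b k) / 2) s x)\<^sup>2"
    unfolding normal_prod_density_def prod.distrib[symmetric] prod_power_distrib ..
  also have "(\<Prod>k\<in>UNIV. exp (- (a k - b k)\<^sup>2 / (8 * (s k)\<^sup>2)))
      = exp (- (\<Sum>k\<in>UNIV. (a k - b k)\<^sup>2 / (8 * (s k)\<^sup>2)))"
    by (simp add: exp_sum[symmetric] sum_negf[symmetric])
  finally show ?thesis .
qed

text \<open>Applied to two Gaussian densities \<open>p\<close>, \<open>q\<close> this bounds \<open>\<integral> min p q\<close> below by \<open>(4 K - 2) / 3\<close>, where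
  \<open>K = \<integral> sqrt (p q) \<ge> exp (-1/8) \<ge> 7/8\<close>. The weight 4 in the AM-GM step makes this bound exactly 1/2.\<close>

lemma four_mult_le_min:
  fixes p q r :: real
  assumes "0 \<le> p" "0 \<le> q" "0 \<le> r" "p * q = r\<^sup>2"
  shows "4 * r \<le> 3 * min p q + p + q"
proof -
  have "(4 * r)\<^sup>2 \<le> (4 * min p q + max p q)\<^sup>2"
  proof -
    have "(4 * r)\<^sup>2 = 16 * (min p q * max p q)"
      using assms by (simp add: power_mult_distrib min_def max_def mult.commute)
    moreover have "0 \<le> (4 * min p q - max p q)\<^sup>2" by simp
    ultimately show ?thesis by (simp add: power2_eq_square algebra_simps)
  qed
  then have "4 * r \<le> 4 * min p q + max p q"
    by (rule power2_le_imp_le) (use assms in \<open>simp add: min_def max_def\<close>)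
  then show ?thesis by (simp add: min_def max_def split: if_splits)
qed

lemma nn_integral_min_normal_prod_density:
  assumes s: "\<And>k. 0 < s k"
    and dist: "(\<Sum>k\<in>UNIV. (a k - b k)\<^sup>2 / (s k)\<^sup>2) \<le> 1"
  shows "ennreal (1 / 2) \<le> (\<integral>\<^sup>+x. min (normal_prod_density a s x) (normal_prod_density b s x) \<partial>Pi\<^sub>M UNIV (\<lambda>_. lborel))"
    (is "_ \<le> ?m")
proof -
  let ?L = "Pi\<^sub>M UNIV (\<lambda>_. lborel) :: ('a \<Rightarrow> real) measure"
  define K where "K = exp (- (\<Sum>k\<in>UNIV. (a k - b k)\<^sup>2 / (8 * (s k)\<^sup>2)))"
  define c where "c = (\<lambda>k. (a k + b k) / 2)"
  have "(\<Sum>k\<in>UNIV. (a k - b k)\<^sup>2 / (8 * (s k)\<^sup>2)) = (\<Sum>k\<in>UNIV. (a k - b k)\<^sup>2 / (s k)\<^sup>2) / 8"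
    by (simp add: sum_divide_distrib mult.commute)
  \<comment> \<open>The exponent is at least \<open>-1/8\<close>, and
    \<open>1 + x \<le> exp x\<close>.\<close>
  then have K: "7 / 8 \<le> K"
    using dist exp_ge_add_one_self[of "- (\<Sum>k\<in>UNIV. (a k - b k)\<^sup>2 / (8 * (s k)\<^sup>2))"]
    by (simp add: K_def)
  \<comment> \<open>The AM-GM bound with the affinity \<open>K\<close> replaced by its lower bound,
    whence \<open>7/2 = 4 * 7/8\<close>. The midpoint density \<open>c\<close> integrates to
    1.\<close>
  have le: "ennreal (7 / 2) * normal_prod_density c s x
      \<le> 3 * ennreal (min (normal_prod_density a s x) (normal_prod_density b s x))
        + (ennreal (normal_prod_density a s x) + ennreal (normal_prod_density b s x))" for x
  proof -
    have "7 / 2 * normal_prod_density c s x \<le> 4 * (K * normal_prod_density c s x)"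
      using mult_right_mono[OF K, of "normal_prod_density c s x"] by simp
    also have "\<dots> \<le> 3 * min (normal_prod_density a s x) (normal_prod_density b s x)
        + normal_prod_density a s x + normal_prod_density b s x"
      using K by (intro four_mult_le_min) (simp_all add: normal_prod_density_mult_shift s K_def c_def)
    finally have "7 / 2 * normal_prod_density c s x \<le> 3 * min (normal_prod_density a s x) (normal_prod_density b s x)
        + (normal_prod_density a s x + normal_prod_density b s x)" by simp
    from ennreal_leI[OF this] show ?thesis
      by (subst ennreal_mult[symmetric]) (simp_all add: ennreal_mult)
  qed
  have "ennreal (7 / 2) = (\<integral>\<^sup>+x. ennreal (7 / 2) * normal_prod_density c s x \<partial>?L)"
    using s by (simp add: nn_integral_cmult nn_integral_normal_prod_density)
  also have "\<dots> \<le> (\<integral>\<^sup>+x. 3 * ennreal (min (normal_prod_density a s x) (normal_prod_density b s x))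
        + (ennreal (normal_prod_density a s x) + ennreal (normal_prod_density b s x)) \<partial>?L)"
    by (intro nn_integral_mono le)
  also have "\<dots> = 3 * ?m + 2"
    using s by (simp add: nn_integral_add nn_integral_cmult nn_integral_normal_prod_density)
  finally have *: "ennreal (7 / 2) \<le> 3 * ?m + 2" .
  show ?thesis
  \<comment> \<open>Subtracting 2 in \<open>*\<close> requires a finite integral; an infinite one
    satisfies the claim trivially.\<close>
  proof (cases ?m)
    case (real r)
    from * have "ennreal (7 / 2) \<le> ennreal (3 * r + 2)"
      using real by (simp add: ennreal_plus ennreal_mult)
    then have "1 / 2 \<le> r" using real by (simp add: ennreal_le_iff del: ennreal_plus)
    then have "ennreal (1 / 2) \<le> ennreal r" by (rule ennreal_leI)
    then show ?thesis using real by simp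
  qed simp
qed

section \<open>Law of the observation and the two-point risk bound\<close>

text \<open>Independence makes the joint law the product of the marginals. Each marginal is a normal
  law shifted by an entry of \<open>A\<close>, and \<open>density_PiM_prod\<close> collects the
  marginal densities into one.\<close>

lemma distr_shifted_noise:
  fixes H :: "'w \<Rightarrow> real^'n^'n" and s :: "'n::finite \<Rightarrow> 'n \<Rightarrow> real"
  assumes "prob_space P" and H: "gaussian_noise P s H" and s: "\<And>i j. 0 < s i j"
  shows "distr P (Pi\<^sub>M UNIV (\<lambda>_. borel)) (\<lambda>\<omega> (i, j). (A + H \<omega>) $ i $ j)
    = density (Pi\<^sub>M UNIV (\<lambda>_. lborel)) (normal_prod_density (\<lambda>(i, j). A $ i $ j) (\<lambda>(i, j). s i j))"
proof -
  interpret prob_space P by fact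
  let ?X = "\<lambda>(i, j) \<omega>. (A + H \<omega>) $ i $ j"
  let ?f = "\<lambda>(i, j). normal_density (A $ i $ j) (s i j)"
  have "indep_vars (\<lambda>_. borel) (\<lambda>(i, j) \<omega>. H \<omega> $ i $ j) UNIV"
    using H by (simp add: gaussian_noise_def)
  then have "indep_vars (\<lambda>_. borel)
      (\<lambda>k \<omega>. (\<lambda>k x. A $ fst k $ snd k + x) k ((\<lambda>(i, j) \<omega>. H \<omega> $ i $ j) k \<omega>)) UNIV"
    by (rule indep_vars_compose2) measurable
  also have "(\<lambda>k \<omega>. (\<lambda>k x. A $ fst k $ snd k + x) k ((\<lambda>(i, j) \<omega>. H \<omega> $ i $ j) k \<omega>)) = ?X"
    by (auto simp: fun_eq_iff)
  finally have ind: "indep_vars (\<lambda>_. borel) ?X UNIV" .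
  have dist: "distributed P lborel (?X k) (?f k)" for k
  proof (cases k)
    case (Pair i j)
    have "distributed P lborel (\<lambda>\<omega>. H \<omega> $ i $ j) (normal_density 0 (s i j))"
      using H by (simp add: gaussian_noise_def)
    from normal_density_affine[OF this s, of 1 "A $ i $ j"] Pair show ?thesis by simp
  qed
  have rv: "random_variable borel (?X k)" for k
    using distributed_measurable[OF dist[of k]] by simp
  have "distr P (Pi\<^sub>M UNIV (\<lambda>_. borel)) (\<lambda>\<omega> (i, j). (A + H \<omega>) $ i $ j)
      = distr P (Pi\<^sub>M UNIV (\<lambda>_. borel)) (\<lambda>\<omega>. \<lambda>k\<in>UNIV. ?X k \<omega>)"
    by (rule distr_cong) (auto simp: fun_eq_iff)
  also have "\<dots> = Pi\<^sub>M UNIV (\<lambda>k. distr P borel (?X k))"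
    using indep_vars_iff_distr_eq_PiM[where I = UNIV and M' = "\<lambda>_. borel" and X = ?X, OF _ rv] ind by simp
  also have "\<dots> = Pi\<^sub>M UNIV (\<lambda>k. density lborel (?f k))"
  proof (intro PiM_cong refl)
    fix k
    \<comment> \<open>Independence is stated over \<open>borel\<close>, densities over
      \<open>lborel\<close>; only the sigma-algebra of the target matters to
      \<open>distr\<close>.\<close>
    have "distr P borel (?X k) = distr P lborel (?X k)"
      by (rule distr_cong) simp_all
    also have "\<dots> = density lborel (?f k)"
      using dist[of k] by (rule distributed_distr_eq_density)
    finally show "distr P borel (?X k) = density lborel (?f k)" .
  qed
  also have "\<dots> = density (Pi\<^sub>M UNIV (\<lambda>_. lborel)) (\<lambda>x. \<Prod>k\<in>UNIV. ennreal (?f k (x k)))"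
  proof (rule density_PiM_prod[symmetric])
    show "product_sigma_finite (\<lambda>_::'n \<times> 'n. lborel :: real measure)" ..
    have "sigma_finite_measure (density lborel (?f k))" for k
      using s by (intro prob_space_imp_sigma_finite) (cases k, simp add: prob_space_normal_density)
    then show "product_sigma_finite (\<lambda>k. density lborel (?f k))" by (rule product_sigma_finite.intro)
  qed (auto split: prod.split)
  also have "\<dots> = density (Pi\<^sub>M UNIV (\<lambda>_. lborel)) (normal_prod_density (\<lambda>(i, j). A $ i $ j) (\<lambda>(i, j). s i j))"
    unfolding normal_prod_density_def
    by (simp add: prod_ennreal case_prod_unfold)
  finally show ?thesis .
qed

lemma abs_component_le_max_norm: "\<bar>A $ i $ j\<bar> \<le> max_norm A"
proof -
  have "{\<bar>A $ i $ j\<bar> | i j. True} = (\<lambda>(i, j). \<bar>A $ i $ j\<bar>) ` UNIV" by auto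
  then have "finite {\<bar>A $ i $ j\<bar> | i j. True}" by simp
  then show ?thesis unfolding max_norm_def by (intro Max_ge) auto
qed

lemma measurable_matrix_of_fun [measurable]:
  "(\<lambda>x. \<chi> i j. x (i, j)) \<in> borel_measurable (Pi\<^sub>M (UNIV :: ('n::finite \<times> 'm::finite) set) (\<lambda>_. borel :: real measure))"
  by (subst borel_measurable_euclidean_space)
     (auto simp: Basis_vec_def inner_axis inner_axis_axis)

lemma measurable_matrix_component [measurable]:
  "(\<lambda>A :: real^'m::finite^'n::finite. A $ i $ j) \<in> borel_measurable borel"
  by (intro borel_measurable_continuous_onI continuous_intros)

text \<open>Keeping one entry of the loss and passing to the law of the observation puts the risks
  of different signals on one common space, where they differ only in the density and in the target
  of the loss.\<close>

lemma risk_ge_nn_integral: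
  fixes H :: "'w \<Rightarrow> real^'n^'n" and s :: "'n::finite \<Rightarrow> 'n \<Rightarrow> real"
  assumes P: "prob_space P" and H: "gaussian_noise P s H" and s: "\<And>i j. 0 < s i j"
    and Mhat [measurable]: "Mhat \<in> borel_measurable borel"
  shows "(\<integral>\<^sup>+x. ennreal (normal_prod_density (\<lambda>(i, j). A $ i $ j) (\<lambda>(i, j). s i j) x)
      * ennreal \<bar>(Mhat (\<chi> i j. x (i, j)) - A) $ i $ j\<bar> \<partial>Pi\<^sub>M UNIV (\<lambda>_. lborel))
    \<le> risk P H Mhat A"
proof -
  let ?B = "Pi\<^sub>M UNIV (\<lambda>_. borel) :: ('n \<times> 'n \<Rightarrow> real) measure"
  let ?X = "\<lambda>\<omega> (i, j). (A + H \<omega>) $ i $ j"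
  let ?g = "\<lambda>x. ennreal \<bar>(Mhat (\<chi> i j. x (i, j)) - A) $ i $ j\<bar>"
  have g: "?g \<in> borel_measurable ?B" by measurable
  have L: "sets (Pi\<^sub>M UNIV (\<lambda>_. lborel) :: ('n \<times> 'n \<Rightarrow> real) measure) = sets ?B"
    by (rule sets_PiM_cong) simp_all
  have Hm: "(\<lambda>\<omega>. H \<omega> $ i $ j) \<in> borel_measurable P" for i j
    using H distributed_measurable[of P lborel "\<lambda>\<omega>. H \<omega> $ i $ j"] by (auto simp: gaussian_noise_def)
  have X: "?X \<in> measurable P ?B"
    by (rule measurable_PiM_single') (auto simp: case_prod_unfold intro!: borel_measurable_add Hm)
  have "(\<integral>\<^sup>+x. ennreal (normal_prod_density (\<lambda>(i, j). A $ i $ j) (\<lambda>(i, j). s i j) x) * ?g x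
        \<partial>Pi\<^sub>M UNIV (\<lambda>_. lborel))
      = (\<integral>\<^sup>+x. ?g x \<partial>density (Pi\<^sub>M UNIV (\<lambda>_. lborel)) (normal_prod_density (\<lambda>(i, j). A $ i $ j) (\<lambda>(i, j). s i j)))"
    using g by (subst nn_integral_density) (simp_all cong: measurable_cong_sets[OF L refl])
  also have "\<dots> = (\<integral>\<^sup>+x. ?g x \<partial>distr P ?B ?X)"
    by (simp only: distr_shifted_noise[OF P H s])
  also have "\<dots> = (\<integral>\<^sup>+\<omega>. ?g (?X \<omega>) \<partial>P)"
    by (rule nn_integral_distr[OF X]) (use g in simp)
  also have "\<dots> = (\<integral>\<^sup>+\<omega>. ennreal \<bar>(Mhat (A + H \<omega>) - A) $ i $ j\<bar> \<partial>P)"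
  proof -
    have "(\<chi> i j. ?X \<omega> (i, j)) = A + H \<omega>" for \<omega>
      by (simp add: vec_eq_iff)
    then show ?thesis by simp
  qed
  also have "\<dots> \<le> risk P H Mhat A"
    unfolding risk_def by (intro nn_integral_mono ennreal_leI abs_component_le_max_norm)
  finally show ?thesis .
qed

text \<open>For every observation the two entrywise losses add up to at least the gap between
  \<open>A\<close> and \<open>B\<close>. Weighting both by the smaller density bounds the sum of the
  risks by the gap times the overlap, which is at least 1/2.\<close>

lemma two_point_risk:
  fixes H :: "'w \<Rightarrow> real^'n^'n" and s :: "'n::finite \<Rightarrow> 'n \<Rightarrow> real"
  assumes P: "prob_space P" and H: "gaussian_noise P s H"
    and \<tau>: "0 < \<tau>" "\<And>i j. \<tau> \<le> s i j"
    and Mhat: "Mhat \<in> borel_measurable borel"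
    and dist: "(\<Sum>i\<in>UNIV. \<Sum>j\<in>UNIV. ((A - B) $ i $ j)\<^sup>2) \<le> \<tau>\<^sup>2"
  shows "ennreal (\<bar>(A - B) $ i $ j\<bar> / 2) \<le> risk P H Mhat A + risk P H Mhat B"
proof -
  let ?L = "Pi\<^sub>M UNIV (\<lambda>_. lborel) :: ('n \<times> 'n \<Rightarrow> real) measure"
  let ?p = "\<lambda>A. normal_prod_density (\<lambda>(i, j). A $ i $ j) (\<lambda>(i, j). s i j)"
  let ?g = "\<lambda>A x. \<bar>(Mhat (\<chi> i j. x (i, j)) - A) $ i $ j\<bar>"
  let ?D = "\<bar>(A - B) $ i $ j\<bar>"
  have s: "0 < s i j" for i j using \<tau> by (rule less_le_trans)
  have L: "sets ?L = sets (Pi\<^sub>M UNIV (\<lambda>_. borel))"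
    by (rule sets_PiM_cong) simp_all
  note Mhat[measurable]
  have g[measurable]: "?g A \<in> borel_measurable ?L" for A
    unfolding measurable_cong_sets[OF L refl] by measurable
  have "(\<Sum>k\<in>UNIV. ((case k of (i, j) \<Rightarrow> A $ i $ j) - (case k of (i, j) \<Rightarrow> B $ i $ j))\<^sup>2
        / (case k of (i, j) \<Rightarrow> s i j)\<^sup>2)
      = (\<Sum>i\<in>UNIV. \<Sum>j\<in>UNIV. ((A - B) $ i $ j)\<^sup>2 / (s i j)\<^sup>2)"
    by (simp add: sum.cartesian_product case_prod_unfold)
  \<comment> \<open>Lowering every standard deviation to \<tau> only increases the normalized
    distance.\<close>
  also have "\<dots> \<le> (\<Sum>i\<in>UNIV. \<Sum>j\<in>UNIV. ((A - B) $ i $ j)\<^sup>2 / \<tau>\<^sup>2)"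
    using \<tau> by (intro sum_mono divide_left_mono power_mono mult_pos_pos zero_less_power s) simp_all
  also have "\<dots> \<le> 1"
    using dist \<tau> by (simp add: sum_divide_distrib[symmetric] divide_le_eq)
  finally have half: "ennreal (1 / 2) \<le> (\<integral>\<^sup>+x. min (?p A x) (?p B x) \<partial>?L)"
    by (intro nn_integral_min_normal_prod_density) (auto simp: s)
  have le: "ennreal ?D * ennreal (min (?p A x) (?p B x))
      \<le> ennreal (?p A x) * ennreal (?g A x) + ennreal (?p B x) * ennreal (?g B x)" for x
  proof -
    \<comment> \<open>Triangle inequality through the estimate.\<close>
    have "?D * min (?p A x) (?p B x) \<le> (?g A x + ?g B x) * min (?p A x) (?p B x)"
      by (intro mult_right_mono) auto
    also have "\<dots> \<le> ?p A x * ?g A x + ?p B x * ?g B x"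
      unfolding distrib_right by (subst (1 2) mult.commute) (intro add_mono mult_right_mono; simp)
    finally have "ennreal (?D * min (?p A x) (?p B x)) \<le> ennreal (?p A x * ?g A x + ?p B x * ?g B x)"
      by (rule ennreal_leI)
    then show ?thesis by (simp add: ennreal_plus ennreal_mult)
  qed
  have "ennreal (?D / 2) = ennreal ?D * ennreal (1 / 2)"
    by (subst ennreal_mult[symmetric]) simp_all
  also have "\<dots> \<le> ennreal ?D * (\<integral>\<^sup>+x. min (?p A x) (?p B x) \<partial>?L)"
    using half by (intro mult_left_mono) simp_all
  also have "\<dots> = (\<integral>\<^sup>+x. ennreal ?D * ennreal (min (?p A x) (?p B x)) \<partial>?L)"
    by (simp add: nn_integral_cmult)
  also have "\<dots> \<le> (\<integral>\<^sup>+x. ennreal (?p A x) * ennreal (?g A x) + ennreal (?p B x) * ennreal (?g B x) \<partial>?L)"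
    by (intro nn_integral_mono le)
  also have "\<dots> = (\<integral>\<^sup>+x. ennreal (?p A x) * ennreal (?g A x) \<partial>?L) + (\<integral>\<^sup>+x. ennreal (?p B x) * ennreal (?g B x) \<partial>?L)"
    by (rule nn_integral_add) measurable
  also have "\<dots> \<le> risk P H Mhat A + risk P H Mhat B"
    by (intro add_mono risk_ge_nn_integral[OF P H s Mhat])
  finally show ?thesis .
qed

section \<open>Pairs of signals close in Frobenius norm but far apart in one entry\<close>

lemma infnorm_cart_le: "(\<And>i. \<bar>x $ i\<bar> \<le> c) \<Longrightarrow> infnorm (x :: real^'n) \<le> c"
  unfolding infnorm_cart by (intro cSup_least) auto

text \<open>The single coordinate \<open>k\<close> certifies the lower bound on
  \<open>infnorm u\<close>.\<close>

lemma signal_classI: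
  assumes "norm u = 1"
    and "1 / 2 * sqrt (\<mu> / real CARD('n)) \<le> \<bar>u $ k\<bar>"
    and "\<And>i. \<bar>u $ i\<bar> \<le> 2 * sqrt (\<mu> / real CARD('n))"
    and "\<tau> * sqrt (real CARD('n)) \<le> l"
  shows "l *\<^sub>R outer_square (u :: real^'n) \<in> signal_class \<mu> \<tau>"
proof -
  have "1 / 2 * sqrt (\<mu> / real CARD('n)) \<le> infnorm u"
    using assms(2) component_le_infnorm_cart[of u k] by linarith
  moreover have "infnorm u \<le> 2 * sqrt (\<mu> / real CARD('n))"
    using assms(3) by (rule infnorm_cart_le)
  ultimately show ?thesis
    using assms(1,4) unfolding signal_class_def by fastforce
qed

text \<open>A coordinate vector has sup norm 1, which is at most \<open>2 * ?T\<close> exactly when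
  \<open>?T\<close> is at least 1/2. Raising the eigenvalue by \<tau> changes one diagonal entry by
  \<tau>, so the Frobenius distance is exactly \<tau>.\<close>

lemma signal_pair_of_large_ratio:
  fixes \<mu> \<tau> :: real
  assumes "\<mu> \<le> real CARD('n)" and "1 / 2 \<le> sqrt (\<mu> / real CARD('n))" and \<tau>: "0 < \<tau>"
  obtains A B :: "real^'n^'n" and i j
  where "A \<in> signal_class \<mu> \<tau>" "B \<in> signal_class \<mu> \<tau>"
    "(\<Sum>i\<in>UNIV. \<Sum>j\<in>UNIV. ((A - B) $ i $ j)\<^sup>2) \<le> \<tau>\<^sup>2"
    "\<tau> * sqrt (3 * \<mu> / real CARD('n)) / 2 \<le> \<bar>(A - B) $ i $ j\<bar>"
proof -
  fix k :: 'n
  let ?T = "sqrt (\<mu> / real CARD('n))"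
  let ?S = "\<lambda>l. l *\<^sub>R outer_square (axis k 1 :: real^'n)"
  let ?l = "\<tau> * sqrt (real CARD('n))"
  have T: "?T \<le> 1" using assms(1) by simp
  have T0: "0 \<le> ?T" using assms(2) by linarith
  have S: "?S l \<in> signal_class \<mu> \<tau>" if "?l \<le> l" for l
  proof (rule signal_classI[where k = k])
    have "1 / 2 * ?T \<le> 1" using T by linarith
    then show "1 / 2 * ?T \<le> \<bar>axis k 1 $ k\<bar>" by simp
    show "\<bar>axis k 1 $ i\<bar> \<le> 2 * ?T" for i
      using assms(2) by (cases "i = k") (auto simp: axis_def intro: order_trans[OF _ assms(2)] simp del: real_sqrt_ge_0_iff)
  qed (use that in simp_all)
  have D: "(?S (?l + \<tau>) - ?S ?l) $ i $ j = (if i = k then if j = k then \<tau> else 0 else 0)" for i j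
    by (auto simp: outer_square_def axis_def algebra_simps)
  have "sqrt (3 * \<mu> / real CARD('n)) = sqrt 3 * ?T"
    by (simp add: real_sqrt_mult[symmetric])
  also have "\<dots> \<le> 2 * 1"
    using T T0 real_sqrt_le_mono[of 3 4] by (intro mult_mono) auto
  finally have le: "\<tau> * sqrt (3 * \<mu> / real CARD('n)) / 2 \<le> \<tau>"
    using \<tau> by simp
  show thesis
  proof (rule that)
    show "?S (?l + \<tau>) \<in> signal_class \<mu> \<tau>" and "?S ?l \<in> signal_class \<mu> \<tau>"
      using \<tau> by (simp_all add: S)
    show "\<tau> * sqrt (3 * \<mu> / real CARD('n)) / 2 \<le> \<bar>(?S (?l + \<tau>) - ?S ?l) $ k $ k\<bar>"
      unfolding D using le \<tau> by simp
    \<comment> \<open>The test on \<open>j\<close> is moved outwards so that the inner sum collapses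
      first.\<close>
    have "(if i = k then if j = k then \<tau> else 0 else 0)\<^sup>2 = (if j = k then if i = k then \<tau>\<^sup>2 else 0 else 0)" for i j
      by simp
    then show "(\<Sum>i\<in>UNIV. \<Sum>j\<in>UNIV. ((?S (?l + \<tau>) - ?S ?l) $ i $ j)\<^sup>2) \<le> \<tau>\<^sup>2"
      unfolding D by simp
  qed
qed

text \<open>Flipping the sign of a single coordinate of size \<^term>\<open>\<epsilon>\<close> moves only one row and one column
  of the rank-one matrix, so the Frobenius distance stays of order \<^term>\<open>\<epsilon>\<close>.\<close>

lemma sum_sq_outer_square_flip:
  fixes u :: "real^'n" and k :: 'n
  defines "v \<equiv> (\<chi> i. if i = k then - (u $ k) else u $ i)"
  shows "(\<Sum>i\<in>UNIV. \<Sum>j\<in>UNIV. ((l *\<^sub>R outer_square u - l *\<^sub>R outer_square v) $ i $ j)\<^sup>2)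
    = 8 * l\<^sup>2 * (u $ k)\<^sup>2 * (\<Sum>i\<in>UNIV - {k}. (u $ i)\<^sup>2)"
proof -
  let ?D = "\<lambda>i j. ((l *\<^sub>R outer_square u - l *\<^sub>R outer_square v) $ i $ j)\<^sup>2"
  let ?c = "4 * l\<^sup>2 * (u $ k)\<^sup>2"
  let ?R = "\<Sum>i\<in>UNIV - {k}. (u $ i)\<^sup>2"
  have row: "(\<Sum>j\<in>UNIV. ?D i j) = ?c * (u $ i)\<^sup>2" if "i \<noteq> k" for i
  proof -
    have "?D i j = (if j = k then ?c * (u $ i)\<^sup>2 else 0)" for j
      using that by (auto simp: v_def outer_square_def power2_eq_square)
    then show ?thesis by simp
  qed
  have "?D k j = ?c * (u $ j)\<^sup>2" if "j \<noteq> k" for j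
    using that by (auto simp: v_def outer_square_def power2_eq_square)
  \<comment> \<open>The diagonal entry is quadratic in the flipped coordinate. Every other entry of
    row and column \<open>k\<close> moves by twice its size, so each of the two contributes a factor
    4 to the total of 8.\<close>
  moreover have "?D k k = 0"
    by (simp add: v_def outer_square_def)
  ultimately have "(\<Sum>j\<in>UNIV. ?D k j) = ?c * ?R"
    by (simp add: sum.remove[of UNIV k] sum_distrib_left)
  moreover have "(\<Sum>i\<in>UNIV - {k}. \<Sum>j\<in>UNIV. ?D i j) = ?c * ?R"
    unfolding sum_distrib_left by (intro sum.cong row) auto
  ultimately have "(\<Sum>i\<in>UNIV. \<Sum>j\<in>UNIV. ?D i j) = ?c * ?R + ?c * ?R"
    by (subst sum.remove[of UNIV k]) simp_all
  then show ?thesis by simp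
qed

lemma norm_eq_1_iff_sum_sq: "norm (u :: real^'n) = 1 \<longleftrightarrow> (\<Sum>i\<in>UNIV. (u $ i)\<^sup>2) = 1"
  by (simp add: norm_vec_def L2_set_def)

lemma signal_pair_of_small_ratio:
  fixes \<mu> \<tau> :: real
  assumes \<mu>: "1 \<le> \<mu>" and small: "sqrt (\<mu> / real CARD('n)) < 1 / 2" and \<tau>: "0 < \<tau>"
  obtains A B :: "real^'n^'n" and i j
  where "A \<in> signal_class \<mu> \<tau>" "B \<in> signal_class \<mu> \<tau>"
    "(\<Sum>i\<in>UNIV. \<Sum>j\<in>UNIV. ((A - B) $ i $ j)\<^sup>2) \<le> \<tau>\<^sup>2"
    "\<tau> * sqrt (3 * \<mu> / real CARD('n)) / 2 \<le> \<bar>(A - B) $ i $ j\<bar>"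
proof -
  define n where "n = real CARD('n)"
  define T where "T = sqrt (\<mu> / n)"
  \<comment> \<open>With eigenvalue \<open>l = \<tau> * sqrt n\<close>, this \<epsilon> makes
    \<open>8 * l\<^sup>2 * \<epsilon>\<^sup>2\<close> equal to \<open>\<tau>\<^sup>2\<close>. Then
    \<open>a\<close> is chosen so that the gap \<open>2 * l * a * \<epsilon>\<close> is exactly the
    required one, and \<open>c\<close> spreads the remaining mass to reach unit norm.\<close>
  define \<epsilon> where "\<epsilon> = 1 / sqrt (8 * n)"
  define a where "a = sqrt (3 / 2) * T"
  define c where "c = sqrt ((1 - a\<^sup>2 - \<epsilon>\<^sup>2) / (n - 2))"
  have n0: "0 < n" by (simp add: n_def)
  have T2: "T\<^sup>2 = \<mu> / n" using \<mu> n0 by (simp add: T_def)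
  have T0: "0 < T" using \<mu> n0 by (simp add: T_def)
  have T: "T < 1 / 2" using small by (simp add: T_def n_def)
  have T4: "T\<^sup>2 < 1 / 4" using power_strict_mono[OF T, of 2] T0 by (simp add: power2_eq_square)
  have nT: "1 / n \<le> T\<^sup>2" unfolding T2 using \<mu> n0 by (simp add: divide_right_mono)
  \<comment> \<open>As \<mu> is at least 1, a small ratio forces \<open>n > 4\<close>: this yields
    two distinct indices and makes \<open>n - 2\<close> positive.\<close>
  then have "1 / n < 1 / 4" using T4 by linarith
  then have n4: "4 < n" using n0 by (simp add: field_simps)
  have e2: "\<epsilon>\<^sup>2 = 1 / (8 * n)" using n0 by (simp add: \<epsilon>_def power_divide)
  have e0: "0 < \<epsilon>" using n0 by (simp add: \<epsilon>_def)
  have a2: "a\<^sup>2 = 3 / 2 * T\<^sup>2" by (simp add: a_def power_mult_distrib)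
  have a0: "0 < a" using T0 by (simp add: a_def)
  have e_small: "\<epsilon>\<^sup>2 \<le> 1 / 32" unfolding e2 using n4 by (simp add: field_simps)
  have rem: "0 \<le> 1 - a\<^sup>2 - \<epsilon>\<^sup>2" using a2 T4 e_small by simp
  have c2: "c\<^sup>2 = (1 - a\<^sup>2 - \<epsilon>\<^sup>2) / (n - 2)" using rem n4 by (simp add: c_def)
  have c0: "0 \<le> c" using rem n4 by (simp add: c_def)
  have T2_nonneg: "0 \<le> T\<^sup>2" by simp
  have sq_2T: "(2 * T)\<^sup>2 = 4 * T\<^sup>2" by (simp add: power_mult_distrib)
  have e_le: "\<epsilon> \<le> 2 * T"
  proof (rule power2_le_imp_le)
    have "\<epsilon>\<^sup>2 \<le> 1 / n" unfolding e2 using n0 by (simp add: field_simps)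
    then show "\<epsilon>\<^sup>2 \<le> (2 * T)\<^sup>2" using nT T2_nonneg sq_2T by linarith
  qed (use T0 in simp)
  have a_le: "a \<le> 2 * T"
    by (rule power2_le_imp_le, use a2 sq_2T T2_nonneg in linarith) (use T0 in simp)
  have a_ge: "T / 2 \<le> a"
  proof (rule power2_le_imp_le)
    have "(T / 2)\<^sup>2 = T\<^sup>2 / 4" by (simp add: power_divide)
    then show "(T / 2)\<^sup>2 \<le> a\<^sup>2" using a2 T2_nonneg by linarith
  qed (use a0 in simp)
  \<comment> \<open>Even the full unit mass spread over \<open>n - 2\<close> coordinates stays
    within the sup norm limit, since \<open>1 / (n - 2) \<le> 4 / n\<close> and
    \<open>1 / n \<le> T\<^sup>2\<close>.\<close>
  have c_le: "c \<le> 2 * T"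
  proof (rule power2_le_imp_le)
    have "c\<^sup>2 \<le> 1 / (n - 2)" unfolding c2 using n4 by (intro divide_right_mono) auto
    also have "\<dots> \<le> 4 * (1 / n)" using n4 by (simp add: field_simps)
    finally show "c\<^sup>2 \<le> (2 * T)\<^sup>2" using nT T2_nonneg sq_2T by linarith
  qed (use T0 in simp)
  have "Suc 0 < CARD('n)" using n4 by (simp add: n_def)
  then obtain p q :: 'n where pq: "p \<noteq> q"
    by (metis card_le_Suc0_iff_eq finite linorder_not_less UNIV_I)
  define u where "u = (\<lambda>e. \<chi> i. if i = p then a else if i = q then e else c)"
  \<comment> \<open>Independent of \<open>e\<close>, so both signs give unit vectors; the same sum
    is the last factor in \<open>sum_sq_outer_square_flip\<close>.\<close>
  have sum_rest: "(\<Sum>i\<in>UNIV - {q}. (u e $ i)\<^sup>2) = 1 - \<epsilon>\<^sup>2" for e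
  proof -
    have "real (card (UNIV - {q} - {p})) = n - 2"
      using pq n4 by (simp add: card_Diff_singleton_if n_def of_nat_diff)
    moreover have "(\<Sum>i\<in>UNIV - {q} - {p}. (u e $ i)\<^sup>2) = (\<Sum>i\<in>UNIV - {q} - {p}. c\<^sup>2)"
      by (intro sum.cong) (auto simp: u_def)
    ultimately have "(\<Sum>i\<in>UNIV - {q} - {p}. (u e $ i)\<^sup>2) = 1 - a\<^sup>2 - \<epsilon>\<^sup>2"
      using n4 by (simp add: c2)
    then show ?thesis
      using pq by (subst sum.remove[of _ p]) (simp_all add: u_def)
  qed
  have norm_u: "norm (u e) = 1" if "e\<^sup>2 = \<epsilon>\<^sup>2" for e
    unfolding norm_eq_1_iff_sum_sq using pq that
    by (subst sum.remove[of _ q]) (simp_all only: sum_rest finite UNIV_I, simp add: u_def)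
  let ?l = "\<tau> * sqrt n"
  let ?S = "\<lambda>e. ?l *\<^sub>R outer_square (u e)"
  have S: "?S e \<in> signal_class \<mu> \<tau>" if "\<bar>e\<bar> = \<epsilon>" for e
  proof (rule signal_classI[where k = p])
    show "norm (u e) = 1" using that by (intro norm_u) (metis power2_abs)
    show "1 / 2 * sqrt (\<mu> / real CARD('n)) \<le> \<bar>u e $ p\<bar>"
      using a_ge a0 by (simp add: u_def T_def n_def)
    show "\<bar>u e $ i\<bar> \<le> 2 * sqrt (\<mu> / real CARD('n))" for i
      using a_le a0 c_le c0 e_le that by (simp add: u_def T_def n_def)
    show "\<tau> * sqrt (real CARD('n)) \<le> ?l" by (simp add: n_def)
  qed
  have flip: "u (- \<epsilon>) = (\<chi> i. if i = q then - (u \<epsilon> $ q) else u \<epsilon> $ i)"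
    using pq by (auto simp: u_def vec_eq_iff)
  have uq: "u \<epsilon> $ q = \<epsilon>" using pq by (simp add: u_def)
  show thesis
  proof (rule that[of "?S \<epsilon>" "?S (- \<epsilon>)" p q])
    have "(\<Sum>i\<in>UNIV. \<Sum>j\<in>UNIV. ((?S \<epsilon> - ?S (- \<epsilon>)) $ i $ j)\<^sup>2) = 8 * ?l\<^sup>2 * \<epsilon>\<^sup>2 * (1 - \<epsilon>\<^sup>2)"
      using sum_sq_outer_square_flip[where l = ?l and u = "u \<epsilon>" and k = q]
      by (simp only: flip uq sum_rest)
    also have "\<dots> = \<tau>\<^sup>2 * (1 - \<epsilon>\<^sup>2)"
      using n0 by (simp add: e2 power_mult_distrib)
    also have "\<dots> \<le> \<tau>\<^sup>2" by (simp add: mult_left_le)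
    finally show "(\<Sum>i\<in>UNIV. \<Sum>j\<in>UNIV. ((?S \<epsilon> - ?S (- \<epsilon>)) $ i $ j)\<^sup>2) \<le> \<tau>\<^sup>2" .
    have D: "(?S \<epsilon> - ?S (- \<epsilon>)) $ p $ q = 2 * ?l * a * \<epsilon>"
      using pq by (simp add: outer_square_def u_def)
    have "\<tau> * sqrt (3 * \<mu> / n) / 2 = 2 * ?l * a * \<epsilon>"
    proof (rule power2_eq_imp_eq)
      show "(\<tau> * sqrt (3 * \<mu> / n) / 2)\<^sup>2 = (2 * ?l * a * \<epsilon>)\<^sup>2"
        using n0 \<mu> by (simp add: power_mult_distrib power_divide a2 e2 T2 mult_ac)
    qed (use \<tau> \<mu> n0 a0 e0 in simp_all)
    then show "\<tau> * sqrt (3 * \<mu> / real CARD('n)) / 2 \<le> \<bar>(?S \<epsilon> - ?S (- \<epsilon>)) $ p $ q\<bar>"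
      unfolding D n_def[symmetric] by linarith
  qed (use e0 in \<open>simp_all add: S\<close>)
qed

section \<open>Minimax risk over the signal class\<close>

theorem theorem20:
  fixes P :: "'w measure"
    and H :: "'w \<Rightarrow> real^'n^'n"
    and s :: "'n::finite \<Rightarrow> 'n \<Rightarrow> real"
    and \<mu> \<sigma>min \<sigma> :: real
  assumes "1 \<le> \<mu>" and "\<mu> \<le> real CARD('n)"
    and "0 < \<sigma>min"
    and "\<And>i j. \<sigma>min \<le> s i j" and "\<And>i j. s i j \<le> \<sigma>"
    and "prob_space P" and "gaussian_noise P s H"
  shows "(INF Mhat \<in> borel_measurable borel. SUP Mstar \<in> signal_class \<mu> \<sigma>min. risk P H Mhat Mstar)
         \<ge> ennreal (\<sigma>min / 8 * sqrt (3 * \<mu> / real CARD('n)))"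
proof (rule INF_greatest)
  let ?T = "sqrt (\<mu> / real CARD('n))"
  fix Mhat :: "real^'n^'n \<Rightarrow> real^'n^'n" assume Mhat: "Mhat \<in> borel_measurable borel"
  obtain A B :: "real^'n^'n" and i j where
    AB: "A \<in> signal_class \<mu> \<sigma>min" "B \<in> signal_class \<mu> \<sigma>min"
    and near: "(\<Sum>i\<in>UNIV. \<Sum>j\<in>UNIV. ((A - B) $ i $ j)\<^sup>2) \<le> \<sigma>min\<^sup>2"
    and far: "\<sigma>min * sqrt (3 * \<mu> / real CARD('n)) / 2 \<le> \<bar>(A - B) $ i $ j\<bar>"
  \<comment> \<open>The threshold is where a coordinate vector starts to meet the upper sup norm
    bound.\<close>
  proof (cases "1 / 2 \<le> ?T")
    case True
    show thesis by (rule signal_pair_of_large_ratio[OF assms(2) True assms(3)]) (rule that)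
  next
    case False
    then have small: "?T < 1 / 2" by simp
    show thesis by (rule signal_pair_of_small_ratio[OF assms(1) small assms(3)]) (rule that)
  qed
  let ?c = "\<sigma>min / 8 * sqrt (3 * \<mu> / real CARD('n))"
  let ?S = "SUP Mstar \<in> signal_class \<mu> \<sigma>min. risk P H Mhat Mstar"
  \<comment> \<open>The supremum dominates the average of the two risks. The constant 1/8 collects
    three halves: from the entry gap, from the overlap and from averaging.\<close>
  have "2 * ennreal ?c = ennreal (2 * ?c)"
    using assms(1,3) by (subst ennreal_mult) simp_all
  also have "\<dots> \<le> ennreal (\<bar>(A - B) $ i $ j\<bar> / 2)"
    using far by (intro ennreal_leI) simp
  also have "\<dots> \<le> risk P H Mhat A + risk P H Mhat B"
    by (rule two_point_risk[OF assms(6,7,3,4) Mhat near])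
  also have "\<dots> \<le> ?S + ?S"
    using AB by (intro add_mono SUP_upper)
  finally have "2 * ennreal ?c \<le> 2 * ?S"
    by (simp only: mult_2)
  then show "ennreal ?c \<le> ?S"
    by (simp add: ennreal_mult_le_mult_iff)
qed

end
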